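(* Let $k>0$ be real and let $z,\gamma\in\mathbb{C}$ be such that all Gamma-function values involved are defined. Let $\langle z\rangle_{\gamma,k}=k^{\gamma}[z/k]^{\gamma}$ and $\langle z\rangle_{\gamma,-k}=k^{\gamma}[z/k]_{\gamma}$ be the generalized rising and falling factorial functions, and let $\Gamma_k$ be the $k$-gamma function. Then $$\langle z\rangle_{\gamma,k}=\frac{\Gamma_k(z+\gamma k)}{\Gamma_k(z)},\qquad \langle z\rangle_{\gamma,-k}=\frac{\Gamma_k(z+k)}{\Gamma_k(z-(\gamma-1)k)}.$$
   Context: For complex $w,\gamma$ set $[w]^{\gamma}:=\Gamma(w+\gamma)/\Gamma(w)$ and $[w]_{\gamma}:=\Gamma(w+1)/\Gamma(w-\gamma+1)$, where $\Gamma$ is the Euler Gamma function (a factor $1/\Gamma$ at a pole of $\Gamma$ is read as $0$). For $n\in\mathbb{N}$ and $k>0$, write $z(z+k)\cdots(z+(n-1)k)$ for the $k$-Pochhammer symbol. For $k>0$ and $z\in\mathbb{C}$ not of the form $-mk$ with $m\in\{0,1,2,\dots\}$, the $k$-gamma function is $$\Gamma_k(z):=\lim_{n\to\infty}\frac{n!\,k^n\,(nk)^{z/k-1}}{z(z+k)\cdots(z+(n-1)k)}.$$ A factor $1/\Gamma_k$ at a pole of $\Gamma_k$ is likewise read as $0$. Here $k^\gamma=e^{\gamma\ln k}$. *)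

theory Defs
  imports "HOL-Analysis.Analysis"
begin

text \<open>\<open>rGamma\<close> is the entire function \<open>1/\<Gamma>\<close>, which vanishes at the poles of \<open>\<Gamma>\<close>.\<close>

definition rising_power :: "complex \<Rightarrow> complex \<Rightarrow> complex" where
  "rising_power w \<gamma> = Gamma (w + \<gamma>) * rGamma w"

definition falling_power :: "complex \<Rightarrow> complex \<Rightarrow> complex" where
  "falling_power w \<gamma> = Gamma (w + 1) * rGamma (w - \<gamma> + 1)"

definition k_rising :: "real \<Rightarrow> complex \<Rightarrow> complex \<Rightarrow> complex" where
  "k_rising k z \<gamma> = of_real k powr \<gamma> * rising_power (z / of_real k) \<gamma>"

definition k_falling :: "real \<Rightarrow> complex \<Rightarrow> complex \<Rightarrow> complex" where
  "k_falling k z \<gamma> = of_real k powr \<gamma> * falling_power (z / of_real k) \<gamma>"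

definition k_pochhammer :: "real \<Rightarrow> complex \<Rightarrow> nat \<Rightarrow> complex" where
  "k_pochhammer k z n = (\<Prod>i<n. z + of_nat i * of_real k)"

text \<open>Meaningful only for \<open>k > 0\<close> and \<open>z\<close> outside \<open>k_gamma_poles k\<close>.\<close>

definition k_gamma :: "real \<Rightarrow> complex \<Rightarrow> complex" where
  "k_gamma k z =
    lim (\<lambda>n. fact n * of_real k ^ n * of_real (real n * k) powr (z / of_real k - 1)
             / k_pochhammer k z n)"

definition k_gamma_poles :: "real \<Rightarrow> complex set" where
  "k_gamma_poles k = {- (of_nat m * of_real k) | m :: nat. True}"

text \<open>The reciprocal \<open>1/\<Gamma>\<^sub>k\<close>, read as \<open>0\<close> at the poles of \<open>\<Gamma>\<^sub>k\<close>.\<close>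

definition rk_gamma :: "real \<Rightarrow> complex \<Rightarrow> complex" where
  "rk_gamma k z = (if z \<in> k_gamma_poles k then 0 else 1 / k_gamma k z)"

end

theory Submission
  imports Defs
begin

text \<open>
  The \<open>k\<close>-gamma function is a rescaled Gamma function,
  \<open>\<Gamma>\<^sub>k(z) = k\<^bsup>z/k - 1\<^esup> \<Gamma>(z/k)\<close>:
  taking the factor \<open>k\<close> out of each of the \<open>n\<close> terms of the \<open>k\<close>-Pochhammer symbol cancels
  \<open>k\<^sup>n\<close>, and what is left of the defining sequence is \<open>k\<^bsup>z/k - 1\<^esup>\<close> times Euler's
  sequence for \<open>\<Gamma>(z/k)\<close>. In a quotient of two values of \<open>\<Gamma>\<^sub>k\<close>, the powers of \<open>k\<close>
  therefore combine to \<open>k\<close> raised to the difference of the arguments divided by \<open>k\<close>. In both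
  claimed identities this difference is \<open>\<gamma>\<close>, and the remaining Gamma quotients are the
  rising and the falling power of \<open>z/k\<close>.
\<close>

lemma k_pochhammer_conv_pochhammer:
  assumes "k > 0"
  shows "k_pochhammer k z n = of_real k ^ n * pochhammer (z / of_real k) n"
proof -
  have "k_pochhammer k z n = (\<Prod>i<n. of_real k * (z / of_real k + of_nat i))"
    unfolding k_pochhammer_def using assms by (intro prod.cong) (auto simp: field_simps)
  then show ?thesis
    by (simp add: prod.distrib pochhammer_prod lessThan_atLeast0)
qed

text \<open>
  At a pole both sides are \<open>0\<close>: there the Pochhammer symbol vanishes for all large \<open>n\<close>, so
  the quotients are eventually \<open>0\<close> by the convention for division by zero, and \<open>Gamma\<close>
  takes the value \<open>0\<close> at its poles. The equation thus holds on the whole plane.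
\<close>

lemma k_gamma_conv_Gamma:
  assumes "k > 0"
  shows "k_gamma k z = of_real k powr (z / of_real k - 1) * Gamma (z / of_real k)"
proof -
  define w where "w = z / of_real k"
  have term_eq: "of_real k powr (w - 1) * Gamma_series' w n =
      fact n * of_real k ^ n * of_real (real n * k) powr (w - 1) / k_pochhammer k z n"
    if "n > 0" for n
  proof -
    have "of_real (real n * k) powr (w - 1) = of_nat n powr (w - 1) * of_real k powr (w - 1)"
      using powr_times_real[of "of_nat n" "of_real k" "w - 1"] assms by simp
    moreover have "of_nat n powr (w - 1) = exp (w * of_real (ln (real n))) / of_nat n"
      using that by (simp add: powr_diff) (simp add: powr_def Ln_of_nat)
    moreover have "(fact n :: complex) = of_nat n * fact (n - 1)"
      using that by (simp add: fact_reduce)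
    ultimately show ?thesis
      using that assms
      by (simp add: Gamma_series'_def k_pochhammer_conv_pochhammer w_def)
  qed
  have "(\<lambda>n. of_real k powr (w - 1) * Gamma_series' w n)
          \<longlonglongrightarrow> of_real k powr (w - 1) * Gamma w"
    by (intro tendsto_intros Gamma_series'_LIMSEQ)
  then have "(\<lambda>n. fact n * of_real k ^ n * of_real (real n * k) powr (w - 1)
                  / k_pochhammer k z n)
          \<longlonglongrightarrow> of_real k powr (w - 1) * Gamma w"
    by (rule Lim_transform_eventually)
      (rule eventually_mono[OF eventually_gt_at_top[of 0] term_eq])
  then show ?thesis
    unfolding k_gamma_def w_def by (rule limI)
qed

lemma k_gamma_poles_iff:
  assumes "k > 0"
  shows "z \<in> k_gamma_poles k \<longleftrightarrow> z / of_real k \<in> \<int>\<^sub>\<le>\<^sub>0"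
  using assms
  by (auto simp: k_gamma_poles_def field_simps elim!: nonpos_Ints_cases')

lemma rk_gamma_conv_rGamma:
  assumes "k > 0"
  shows "rk_gamma k z = of_real k powr (1 - z / of_real k) * rGamma (z / of_real k)"
proof -
  have "of_real k powr (1 - z / of_real k) =
      inverse ((of_real k :: complex) powr (z / of_real k - 1))"
    by (simp flip: powr_minus)
  then show ?thesis
    using assms
    by (auto simp: rk_gamma_def k_gamma_poles_iff k_gamma_conv_Gamma Gamma_eq_zero_iff
        rGamma_inverse_Gamma divide_inverse)
qed

lemma k_gamma_times_rk_gamma:
  assumes "k > 0"
  shows "k_gamma k x * rk_gamma k y =
    of_real k powr ((x - y) / of_real k) * (Gamma (x / of_real k) * rGamma (y / of_real k))"
proof -
  have "(of_real k :: complex) powr (x / of_real k - 1) * of_real k powr (1 - y / of_real k) =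
      of_real k powr ((x - y) / of_real k)"
    by (simp add: diff_divide_distrib flip: powr_add)
  then show ?thesis
    using assms by (simp add: k_gamma_conv_Gamma rk_gamma_conv_rGamma ac_simps)
qed

theorem theorem1p2:
  fixes k :: real and z \<gamma> :: complex
  assumes "k > 0"
  shows "(z / of_real k + \<gamma> \<notin> \<int>\<^sub>\<le>\<^sub>0 \<longrightarrow>
            k_rising k z \<gamma> = k_gamma k (z + \<gamma> * of_real k) * rk_gamma k z) \<and>
         (z / of_real k + 1 \<notin> \<int>\<^sub>\<le>\<^sub>0 \<longrightarrow>
            k_falling k z \<gamma> =
              k_gamma k (z + of_real k) * rk_gamma k (z - (\<gamma> - 1) * of_real k))"
proof -
  have k: "(of_real k :: complex) \<noteq> 0"
    using assms by simp
  have quot: "(z + \<gamma> * of_real k) / of_real k = z / of_real k + \<gamma>"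
      "(z + of_real k) / of_real k = z / of_real k + 1"
      "(z - (\<gamma> - 1) * of_real k) / of_real k = z / of_real k - \<gamma> + 1"
    using k by (simp_all add: field_simps)
  have exponent: "(z + \<gamma> * of_real k - z) / of_real k = \<gamma>"
      "(z + of_real k - (z - (\<gamma> - 1) * of_real k)) / of_real k = \<gamma>"
    using k by (simp_all add: field_simps)
  show ?thesis
    unfolding k_gamma_times_rk_gamma[OF assms] quot exponent
    by (simp add: k_rising_def k_falling_def rising_power_def falling_power_def)
qed

end
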